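(* Let $p_X$ be a probability density on $\mathbb{R}^d$, $A\in\mathbb{R}^{m\times d}$, $\sigma>0$, and let all objects ($p_{X,t}$, $p_Y$, $p_{Y,t}$, $p_{\theta}$, $p_{\theta,t}$, $p_{\theta,Y,t}$, $f_\phi$, $f_\psi$, $\mathcal{L}_{\mathrm{distill}}$, $\varepsilon_{\phi,2}$, $\varepsilon_{\phi,4}$, $\varepsilon_\psi(\hat\theta)$, $\Delta(\hat\theta)$) be as defined in the context, with $\hat\theta\in\Theta$. Assume: (i) there exists $\lambda_0>0$ such that $\chi^2(p\|p_{Y,t})\le\lambda_0^{-1}\int\|\nabla(p/p_{Y,t})\|^2\,dp_{Y,t}$ for all $t$ and all $p\in\{p_{\theta,Y,t}\}_{\theta\in\Theta}$; (ii) there exists $\theta^*\in\Theta$ with $p_{\theta^*,Y}=p_Y$, and for some $\varepsilon_{\mathrm{opt}}\ge0$, $\mathcal{L}_{\mathrm{distill}}(\hat\theta)\le\mathcal{L}_{\mathrm{distill}}(\theta^* )+\varepsilon_{\mathrm{opt}}$; moreover $\mathbb{E}_{t}\mathbb{E}_{y_t\sim p_{Y,t}}\|f_\phi(y_t,t)-f_\psi(y_t,t)\|_2^2\le\mathbb{E}_{t}\mathbb{E}_{y_t\sim p_{Y,t}}\|f_\phi(y_t,t)-s_{Y,t}(y_t)\|_2^2$. Then the following hold, where $a\lesssim b$ means $a\le Cb$ for an absolute constant $C>0$: 1. $$\mathbb{E}_t\mathcal{F}(p_{\hat\theta,Y,t}\|p_{Y,t})\lesssim\left(\varepsilon_{\phi,4}^2\sqrt{\frac{\Delta(\hat\theta)}{\lambda_0}}+\sqrt{\varepsilon_{\phi,4}^4\frac{\Delta(\hat\theta)}{\lambda_0}+\varepsilon_{\phi,2}^2+\varepsilon_\psi^2(\hat\theta)+\varepsilon_{\mathrm{opt}}}\right)^2.$$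 2. If $\mathbb{E}_t\mathcal{F}(p_{\hat\theta,t}\|p_{X,t})\le\hat\kappa\cdot\mathbb{E}_t\mathcal{F}(p_{\hat\theta,Y,t}\|p_{Y,t})$ for some $\hat\kappa>0$, then $$\mathbb{E}_t\mathcal{F}(p_{\hat\theta,t}\|p_{X,t})\lesssim\hat\kappa\left(\varepsilon_{\phi,4}^2\sqrt{\frac{\Delta(\hat\theta)}{\lambda_0}}+\sqrt{4\varepsilon_{\phi,4}^4\frac{\Delta(\hat\theta)}{\lambda_0}+\varepsilon_{\phi,2}^2+\varepsilon_\psi^2(\hat\theta)+\varepsilon_{\mathrm{opt}}}\right)^2.$$
   Context: Time $t$ is drawn from a fixed probability distribution; $\mathbb{E}_t$ is expectation over it, and $\sigma_t>0$ is a noise schedule. For a law $p$ on $\mathbb{R}^d$, $\mathcal{T}[p]:=A_\sharp p*\mathcal{N}(0,\sigma^2I_m)$ (law of $Ax+\sigma\epsilon$). $p_Y:=\mathcal{T}[p_X]$. $p_{X,t}=p_X*\mathcal{N}(0,\sigma_t^2I_d)$ and $p_{Y,t}=p_Y*\mathcal{N}(0,\sigma_t^2I_m)$ are the noise-convolved marginals. For each $\theta\in\Theta$ a generator $G_\theta$ has output law $p_\theta$ on $\mathbb{R}^d$; $p_{\theta,t}=p_\theta*\mathcal{N}(0,\sigma_t^2I_d)$, $p_{\theta,Y}:=\mathcal{T}[p_\theta]$, $p_{\theta,Y,t}=p_{\theta,Y}*\mathcal{N}(0,\sigma_t^2I_m)$. Let $s_{Y,t}=\nabla\log p_{Y,t}$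 and $s_{\theta,Y,t}=\nabla\log p_{\theta,Y,t}$. Two fixed functions $f_\phi(y,t),f_\psi(y,t)\in\mathbb{R}^m$ (teacher and fake diffusion model) are given. $\mathcal{L}_{\mathrm{distill}}(\theta):=\mathbb{E}_t\mathbb{E}_{\tilde y_t\sim p_{\theta,Y,t}}\|f_\phi(\tilde y_t,t)-f_\psi(\tilde y_t,t)\|_2^2$. $\delta_\phi(y,t):=f_\phi(y,t)-s_{Y,t}(y)$; $\varepsilon_{\phi,2}^2:=\sup_t\mathbb{E}_{y\sim p_{Y,t}}\|\delta_\phi(y,t)\|_2^2$; $\varepsilon_{\phi,4}^2:=\sup_t\left(\mathbb{E}_{y\sim p_{Y,t}}\|\delta_\phi(y,t)\|_2^4\right)^{1/2}$. With $\delta_\psi(y,t):=f_\psi(y,t)-s_{\hat\theta,Y,t}(y)$, $\varepsilon_\psi^2(\hat\theta):=\sup_t\mathbb{E}_{y\sim p_{\hat\theta,Y,t}}\|\delta_\psi(y,t)\|_2^2$. $\Delta(\hat\theta):=\sup_t\sup_y p_{\hat\theta,Y,t}(y)/p_{Y,t}(y)$. $\mathcal{F}(p\|q):=\mathbb{E}_{x\sim p}\|\nabla\log p(x)-\nabla\log q(x)\|_2^2$ is the Fisher divergence and $\chi^2(p\|q)=\int(p/q-1)^2\,dq$ the chi-square divergence. Throughout, densities are assumed sufficiently regular that all scores and gradients are well-defined, and the quantities above are finite. *)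

theory Defs
  imports "HOL-Probability.Probability"
begin

definition gauss_density :: "real \<Rightarrow> real^'n \<Rightarrow> real" where
  "gauss_density s x = (\<Prod>i\<in>UNIV. normal_density 0 s (x $ i))"

text \<open>The isotropic Gaussian law $N(0, s^2 I)$; the parameter is the standard deviation.\<close>

definition gaussian :: "real \<Rightarrow> (real^'n) measure" where
  "gaussian s = density lborel (\<lambda>x. ennreal (gauss_density s x))"

text \<open>\<open>noised M s\<close> is the smooth, everywhere positive version of the Lebesgue density of
  \<open>M \<star> gaussian s\<close> (the law \<open>M\<close> itself may be singular). Fixing this version makes
  scores and density ratios well defined at every point.\<close>

definition noised :: "(real^'n) measure \<Rightarrow> real \<Rightarrow> real^'n \<Rightarrow> real" where
  "noised M s x = (\<integral>y. gauss_density s (x - y) \<partial>M)"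

lemma gauss_density_measurable [measurable]: "gauss_density s \<in> borel_measurable borel"
  unfolding gauss_density_def[abs_def] by measurable

lemma gauss_density_pos: "0 < s \<Longrightarrow> 0 < gauss_density s x"
  unfolding gauss_density_def by (intro prod_pos) (simp add: normal_density_pos)

lemma gauss_density_nonneg: "0 \<le> gauss_density s x"
  unfolding gauss_density_def by (intro prod_nonneg) simp

lemma gauss_density_bound:
  fixes x :: "real^'n"
  assumes "0 < s"
  shows "gauss_density s x \<le> gauss_density s (0 :: real^'n)"
  unfolding gauss_density_def
proof (intro prod_mono conjI)
  fix i :: 'n
  show "normal_density 0 s (x $ i) \<le> normal_density 0 s ((0 :: real^'n) $ i)"
    unfolding normal_density_def using assms by (intro mult_left_mono) auto
qed simp

lemma prob_space_gaussian:
  assumes "0 < s"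
  shows "prob_space (gaussian s :: (real^'n) measure)"
proof
  have A: "(\<integral>\<^sup>+x. ennreal (normal_density 0 s x) \<partial>lborel) = 1"
    using assms by (subst nn_integral_eq_integral) auto
  have B: "(Basis :: (real^'n) set) = (\<lambda>i. axis i 1) ` UNIV"
    by (auto simp: Basis_vec_def)
  have inj: "inj (\<lambda>i::'n. axis i (1::real))"
    by (auto simp: inj_on_def axis_eq_axis)
  have "emeasure (gaussian s :: (real^'n) measure) (space (gaussian s))
      = (\<integral>\<^sup>+x. ennreal (gauss_density s (x :: real^'n)) \<partial>lborel)"
    by (simp add: gaussian_def emeasure_density)
  also have "\<dots> = (\<integral>\<^sup>+x. (\<Prod>b\<in>(Basis :: (real^'n) set). ennreal (normal_density 0 s (x \<bullet> b))) \<partial>lborel)"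
    unfolding gauss_density_def B by (subst prod.reindex[OF inj]) (simp add: prod_ennreal inner_axis)
  also have "\<dots> = (\<Prod>b\<in>(Basis :: (real^'n) set). \<integral>\<^sup>+x. ennreal (normal_density 0 s x) \<partial>lborel)"
    by (rule nn_integral_lborel_prod) auto
  also have "\<dots> = 1" by (simp add: A)
  finally show "emeasure (gaussian s :: (real^'n) measure) (space (gaussian s)) = 1" .
qed

lemma integrable_gauss_density:
  fixes M :: "(real^'n) measure"
  assumes "prob_space M" "sets M = sets borel" "0 < s"
  shows "integrable M (\<lambda>y. gauss_density s (x - y))"
proof -
  interpret prob_space M by fact
  note [measurable_cong] = assms(2)
  show ?thesis
    by (intro integrable_const_bound[where B = "gauss_density s (0 :: real^'n)"] AE_I2)
      (simp_all add: gauss_density_bound[OF assms(3)] gauss_density_nonneg)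
qed

lemma noised_pos:
  assumes "prob_space M" "sets M = sets borel" "0 < s"
  shows "0 < noised M s x"
proof -
  interpret prob_space M by fact
  have "noised M s x \<noteq> 0"
  proof
    assume "noised M s x = 0"
    then have "AE y in M. gauss_density s (x - y) = 0"
      unfolding noised_def
      using integral_nonneg_eq_0_iff_AE[OF integrable_gauss_density[OF assms]] gauss_density_nonneg
      by blast
    then have "AE y in M. False"
      by eventually_elim (use gauss_density_pos[OF assms(3)] in \<open>auto simp: less_le\<close>)
    then show False by simp
  qed
  moreover have "0 \<le> noised M s x"
    unfolding noised_def by (intro integral_nonneg_AE) (simp add: gauss_density_nonneg)
  ultimately show ?thesis by simp
qed

lemma convolution_gaussian_eq_noised:
  fixes M :: "(real^'n) measure"
  assumes "prob_space M" "sets M = sets borel" "0 < s"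
  shows "(M \<star> gaussian s) = density lborel (\<lambda>x. ennreal (noised M s x))"
proof (rule measure_eqI)
  show "sets (M \<star> gaussian s) = sets (density lborel (\<lambda>x. ennreal (noised M s x)))" by simp
next
  fix B assume "B \<in> sets (M \<star> gaussian s)"
  then have B [measurable]: "B \<in> sets borel" by simp
  interpret M: prob_space M by fact
  interpret N: prob_space "gaussian s :: (real^'n) measure" by (rule prob_space_gaussian) fact
  interpret L: sigma_finite_measure "lborel :: (real^'n) measure" by (rule sigma_finite_lborel)
  interpret P: pair_sigma_finite M "lborel :: (real^'n) measure" ..
  note [measurable_cong] = assms(2)
  have s: "sets (gaussian s :: (real^'n) measure) = sets borel" by (simp add: gaussian_def)
  have nn: "ennreal (noised M s x) = (\<integral>\<^sup>+y. ennreal (gauss_density s (x - y)) \<partial>M)" for x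
    unfolding noised_def
    by (rule nn_integral_eq_integral[symmetric, OF integrable_gauss_density[OF assms]])
      (simp add: gauss_density_nonneg)
  have shift: "(\<integral>\<^sup>+z. ennreal (gauss_density s z) * indicator B (y + z) \<partial>lborel)
      = (\<integral>\<^sup>+x. ennreal (gauss_density s (x - y)) * indicator B x \<partial>lborel)" for y :: "real^'n"
    by (subst (2) lborel_affine[of 1 y]) (simp_all add: nn_integral_density nn_integral_distr)
  have "emeasure (M \<star> gaussian s) B = (\<integral>\<^sup>+y. \<integral>\<^sup>+z. indicator B (y + z) \<partial>gaussian s \<partial>M)"
    by (rule convolution_emeasure'[OF B M.finite_measure_axioms N.finite_measure_axioms s assms(2)])
  also have "\<dots> = (\<integral>\<^sup>+y. \<integral>\<^sup>+z. ennreal (gauss_density s z) * indicator B (y + z) \<partial>lborel \<partial>M)"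
    unfolding gaussian_def by (simp add: nn_integral_density)
  also have "\<dots> = (\<integral>\<^sup>+y. \<integral>\<^sup>+x. ennreal (gauss_density s (x - y)) * indicator B x \<partial>lborel \<partial>M)"
    by (simp add: shift)
  also have "\<dots> = (\<integral>\<^sup>+x. \<integral>\<^sup>+y. ennreal (gauss_density s (x - y)) * indicator B x \<partial>M \<partial>lborel)"
    by (rule P.Fubini'[symmetric]) measurable
  also have "\<dots> = (\<integral>\<^sup>+x. ennreal (noised M s x) * indicator B x \<partial>lborel)"
    by (simp add: nn nn_integral_multc)
  also have "\<dots> = emeasure (density lborel (\<lambda>x. ennreal (noised M s x))) B"
    by (subst emeasure_density) (auto simp: nn)
  finally show "emeasure (M \<star> gaussian s) B = emeasure (density lborel (\<lambda>x. ennreal (noised M s x))) B" .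
qed


lemma gauss_density_eq_exp:
  fixes x :: "real^'n"
  shows "gauss_density s x = (1 / sqrt (2 * pi * s\<^sup>2)) ^ CARD('n) * exp (- (x \<bullet> x) / (2 * s\<^sup>2))"
proof -
  have "gauss_density s x = (1 / sqrt (2 * pi * s\<^sup>2)) ^ CARD('n) * (\<Prod>i\<in>UNIV. exp (- (x $ i)\<^sup>2 / (2 * s\<^sup>2)))"
    unfolding gauss_density_def normal_density_def prod.distrib by simp
  also have "(\<Prod>i\<in>UNIV. exp (- (x $ i)\<^sup>2 / (2 * s\<^sup>2))) = exp (- (x \<bullet> x) / (2 * s\<^sup>2))"
    by (simp add: exp_sum[symmetric] inner_vec_def power2_eq_square sum_divide_distrib sum_negf)
  finally show ?thesis .
qed

lemma gauss_density_mult_inner_le: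
  fixes x :: "real^'n"
  assumes "0 < s"
  shows "gauss_density s x * (x \<bullet> x) \<le> gauss_density s (0 :: real^'n) * (2 * s\<^sup>2)"
proof -
  define u where "u = (x \<bullet> x) / (2 * s\<^sup>2)"
  have xx: "x \<bullet> x = 2 * s\<^sup>2 * u" using assms by (simp add: u_def)
  have "u \<le> exp u" using exp_ge_add_one_self[of u] by linarith
  then have "exp (- u) * u \<le> 1" by (simp add: exp_minus field_simps)
  then have "(2 * s\<^sup>2) * (exp (- u) * u) \<le> (2 * s\<^sup>2) * 1"
    by (intro mult_left_mono) auto
  moreover have "exp (- (x \<bullet> x) / (2 * s\<^sup>2)) = exp (- u)" by (simp add: u_def)
  ultimately have "exp (- (x \<bullet> x) / (2 * s\<^sup>2)) * (x \<bullet> x) \<le> 2 * s\<^sup>2"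
    by (simp add: xx mult_ac)
  then show ?thesis
    unfolding gauss_density_eq_exp
    by (simp add: mult.assoc mult_left_mono)
qed

lemma gauss_density_taylor:
  fixes z h :: "real^'n"
  assumes s: "0 < s"
  shows "\<bar>gauss_density s (z + h) - gauss_density s z + gauss_density s z * (z \<bullet> h) / s\<^sup>2\<bar>
    \<le> 3 * gauss_density s (0 :: real^'n) / (2 * s\<^sup>2) * (h \<bullet> h)"
proof -
  define c :: real where "c = (1 / sqrt (2 * pi * s\<^sup>2)) ^ CARD('n)"
  define v where "v = s\<^sup>2"
  have v: "0 < v" using s by (simp add: v_def)
  define q where "q t = z \<bullet> z + 2 * t * (z \<bullet> h) + t\<^sup>2 * (h \<bullet> h)" for t :: real
  define r where "r t = z \<bullet> h + t * (h \<bullet> h)" for t :: real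
  define g where "g t = c * exp (- q t / (2 * v))" for t :: real
  have gd: "g t = gauss_density s (z + t *\<^sub>R h)" for t
    unfolding g_def c_def gauss_density_eq_exp q_def v_def
    by (simp add: inner_simps inner_commute power2_eq_square algebra_simps)
  have rw: "r t = (z + t *\<^sub>R h) \<bullet> h" for t by (simp add: r_def inner_simps)
  define diff where "diff m t = (if m = 0 then g t else if m = 1 then - g t * r t / v
     else g t * ((r t)\<^sup>2 / v\<^sup>2 - (h \<bullet> h) / v))" for m :: nat and t :: real
  have dg: "DERIV g t :> - g t * r t / v" for t
    unfolding g_def q_def r_def using v
    by (auto intro!: derivative_eq_intros simp: field_simps)
  have dr: "DERIV r t :> h \<bullet> h" for t
    unfolding r_def by (auto intro!: derivative_eq_intros)
  have dg2: "DERIV (\<lambda>t. - g t * r t / v) t :> g t * ((r t)\<^sup>2 / v\<^sup>2 - (h \<bullet> h) / v)" for t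
    using v by (auto intro!: derivative_eq_intros dg dr simp: field_simps power2_eq_square)
  have "\<exists>t>0. t \<le> 1 \<and> g 1 = (\<Sum>m<2. diff m 0 / fact m * 1 ^ m) + diff 2 t / fact 2 * 1 ^ 2"
  proof (rule Maclaurin2)
    show "\<forall>m t. m < 2 \<and> 0 \<le> t \<and> t \<le> 1 \<longrightarrow> DERIV (diff m) t :> diff (Suc m) t"
    proof (intro allI impI)
      fix m :: nat and t :: real assume "m < 2 \<and> 0 \<le> t \<and> t \<le> 1"
      then consider "m = 0" | "m = 1" by linarith
      then show "DERIV (diff m) t :> diff (Suc m) t"
        by cases (use dg[of t] dg2[of t] in \<open>simp_all add: diff_def[abs_def]\<close>)
    qed
  qed (auto simp: diff_def)
  then obtain t where "g 1 = (\<Sum>m<2. diff m 0 / fact m * 1 ^ m) + diff 2 t / fact 2 * 1 ^ 2" by blast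
  then have eq: "g 1 - g 0 + g 0 * r 0 / v = g t * ((r t)\<^sup>2 / v\<^sup>2 - (h \<bullet> h) / v) / 2"
    by (simp add: numeral_2_eq_2 diff_def)
  let ?w = "z + t *\<^sub>R h" and ?g0 = "gauss_density s (0 :: real^'n)"
  have g0: "0 \<le> g t" "g t \<le> ?g0" by (simp_all add: gd gauss_density_nonneg gauss_density_bound s)
  have "g t * (r t)\<^sup>2 \<le> g t * ((?w \<bullet> ?w) * (h \<bullet> h))"
    unfolding rw by (intro mult_left_mono Cauchy_Schwarz_ineq g0)
  also have "\<dots> = (g t * (?w \<bullet> ?w)) * (h \<bullet> h)" by simp
  also have "\<dots> \<le> (?g0 * (2 * v)) * (h \<bullet> h)"
    unfolding gd v_def by (intro mult_right_mono gauss_density_mult_inner_le s) auto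
  finally have a: "g t * (r t)\<^sup>2 / v\<^sup>2 \<le> ?g0 * (2 * v) * (h \<bullet> h) / v\<^sup>2"
    by (intro divide_right_mono) auto
  have a': "?g0 * (2 * v) * (h \<bullet> h) / v\<^sup>2 = 2 * ?g0 * (h \<bullet> h) / v"
    using v by (simp add: power2_eq_square)
  have b: "g t * (h \<bullet> h) / v \<le> ?g0 * (h \<bullet> h) / v"
    using v by (intro divide_right_mono mult_right_mono g0) auto
  have c: "0 \<le> g t * (r t)\<^sup>2 / v\<^sup>2" "0 \<le> g t * (h \<bullet> h) / v" "0 \<le> ?g0 * (h \<bullet> h) / v"
    using g0 v by auto
  have eq': "g 1 - g 0 + g 0 * r 0 / v = (g t * (r t)\<^sup>2 / v\<^sup>2 - g t * (h \<bullet> h) / v) / 2"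
    unfolding eq by (simp add: algebra_simps)
  have "\<bar>g 1 - g 0 + g 0 * r 0 / v\<bar> \<le> 3 * ?g0 * (h \<bullet> h) / v / 2"
  proof -
    define X Y P where "X = g t * (r t)\<^sup>2 / v\<^sup>2" and "Y = g t * (h \<bullet> h) / v" and "P = ?g0 * (h \<bullet> h) / v"
    have P: "2 * ?g0 * (h \<bullet> h) / v = 2 * P" "3 * ?g0 * (h \<bullet> h) / v / 2 = 3 * P / 2"
      by (simp_all add: P_def)
    have "X \<le> 2 * P" "Y \<le> P" "0 \<le> X" "0 \<le> Y" "0 \<le> P"
      using a b c unfolding a' P(1) X_def[symmetric] Y_def[symmetric] P_def[symmetric] by auto
    then have "\<bar>(X - Y) / 2\<bar> \<le> 3 * P / 2" by (simp add: abs_le_iff)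
    then show ?thesis unfolding eq' P(2) X_def Y_def .
  qed
  then show ?thesis by (simp add: gd r_def v_def mult_ac)
qed

lemma noised_gderiv:
  fixes M :: "(real^'n) measure"
  assumes M: "prob_space M" "sets M = sets borel" and s: "0 < s"
  shows "GDERIV (noised M s) x :> (\<integral>y. (- gauss_density s (x - y) / s\<^sup>2) *\<^sub>R (x - y) \<partial>M)"
    (is "GDERIV _ _ :> ?G")
proof -
  interpret prob_space M by fact
  note [measurable_cong] = assms(2)
  let ?g0 = "gauss_density s (0 :: real^'n)"
  have bnd: "norm ((- gauss_density s z / s\<^sup>2) *\<^sub>R z) \<le> (?g0 + ?g0 * (2 * s\<^sup>2)) / s\<^sup>2" for z :: "real^'n"
  proof -
    have "2 * norm z \<le> 1 + norm z ^ 2" using sum_squares_bound[of 1 "norm z"] by simp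
    then have "norm z \<le> 1 + z \<bullet> z"
      using norm_ge_zero[of z] unfolding power2_norm_eq_inner by linarith
    then have "gauss_density s z * norm z \<le> gauss_density s z * (1 + z \<bullet> z)"
      by (intro mult_left_mono gauss_density_nonneg)
    also have "\<dots> \<le> ?g0 + ?g0 * (2 * s\<^sup>2)"
      using gauss_density_bound[OF s, of z] gauss_density_mult_inner_le[OF s, of z]
      by (simp add: distrib_left)
    finally have "gauss_density s z * norm z / s\<^sup>2 \<le> (?g0 + ?g0 * (2 * s\<^sup>2)) / s\<^sup>2"
      by (intro divide_right_mono) auto
    then show ?thesis by (simp add: gauss_density_nonneg)
  qed
  have intG: "integrable M (\<lambda>y. (- gauss_density s (x - y) / s\<^sup>2) *\<^sub>R (x - y))"
    by (intro integrable_const_bound[where B = "(?g0 + ?g0 * (2 * s\<^sup>2)) / s\<^sup>2"] AE_I2 bnd) measurable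
  let ?K = "3 * ?g0 / (2 * s\<^sup>2)"
  have K: "norm (noised M s y - noised M s x - (y - x) \<bullet> ?G) / norm (y - x) \<le> ?K * norm (y - x)"
    for y
  proof (cases "y = x")
    case False
    define h where "h = y - x"
    let ?f = "\<lambda>w. gauss_density s (x + h - w) - gauss_density s (x - w)
       - h \<bullet> ((- gauss_density s (x - w) / s\<^sup>2) *\<^sub>R (x - w))"
    have "noised M s (x + h) - noised M s x - h \<bullet> ?G = (\<integral>w. ?f w \<partial>M)"
      unfolding noised_def
      by (simp only: integral_inner_right[OF intG]
          Bochner_Integration.integral_diff[OF _ integrable_inner_right[OF intG]]
          Bochner_Integration.integral_diff Bochner_Integration.integrable_diff
          integrable_gauss_density[OF M s])
    then have eq: "noised M s y - noised M s x - (y - x) \<bullet> ?G = (\<integral>w. ?f w \<partial>M)"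
      by (simp add: h_def)
    have "norm (\<integral>w. ?f w \<partial>M) \<le> ?K * (h \<bullet> h)"
    proof -
      have "norm (?f w) \<le> ?K * (h \<bullet> h)" for w
        using gauss_density_taylor[OF s, of "x - w" h]
        by (simp add: algebra_simps inner_commute diff_divide_distrib)
      then have "(\<integral>w. norm (?f w) \<partial>M) \<le> (\<integral>w. ?K * (h \<bullet> h) \<partial>M)"
        using intG integrable_gauss_density[OF M s]
        by (intro integral_mono integrable_norm Bochner_Integration.integrable_diff
            integrable_inner_right) auto
      then show ?thesis
        by (intro order.trans[OF integral_norm_bound]) (simp add: prob_space)
    qed
    then show ?thesis
      using False unfolding eq
      by (simp add: h_def divide_le_eq mult.assoc dot_square_norm power2_eq_square)
  qed auto
  have "(noised M s has_derivative (\<lambda>h. h \<bullet> ?G)) (at x)"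
  proof (rule has_derivativeI_sandwich[where e = 1 and H = "\<lambda>y. ?K * norm (y - x)"])
    show "((\<lambda>y. ?K * norm (y - x)) \<longlongrightarrow> 0) (at x)"
      using s by (auto intro!: tendsto_eq_intros)
    show "bounded_linear (\<lambda>h. h \<bullet> ?G)" by (rule bounded_linear_inner_left)
    show "norm (noised M s y - noised M s x - (y - x) \<bullet> ?G) / norm (y - x) \<le> ?K * norm (y - x)" for y
      by (rule K)
  qed simp_all
  then show ?thesis by (simp add: gderiv_def)
qed

text \<open>The law of \<open>A x + \<sigma> \<epsilon>\<close> for \<open>x\<close> distributed as \<open>M\<close> and independent
  standard Gaussian \<open>\<epsilon>\<close>.\<close>

definition corrupt :: "real^'d^'m \<Rightarrow> real \<Rightarrow> (real^'d) measure \<Rightarrow> (real^'m) measure" where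
  "corrupt A \<sigma> M = (distr M borel (\<lambda>x. A *v x) \<star> gaussian \<sigma>)"

definition grad :: "(real^'n \<Rightarrow> real) \<Rightarrow> real^'n \<Rightarrow> real^'n" where
  "grad f x = (THE D. GDERIV f x :> D)"

lemma grad_eq:
  assumes "GDERIV f x :> D"
  shows "grad f x = D"
  unfolding grad_def
proof (rule the_equality)
  show "GDERIV f x :> D" by (rule assms)
next
  fix E assume "GDERIV f x :> E"
  then have "(\<lambda>h. inner h E) = (\<lambda>h. inner h D)"
    using assms has_derivative_unique unfolding gderiv_def by blast
  then have "inner (E - D) E = inner (E - D) D" by metis
  then have "inner (E - D) (E - D) = 0" by (simp add: inner_diff_right)
  then show "E = D" by simp
qed

definition score :: "(real^'n \<Rightarrow> real) \<Rightarrow> real^'n \<Rightarrow> real^'n" where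
  "score p = grad (\<lambda>x. ln (p x))"

text \<open>From here on laws with a density are represented by their density functions, and all
  expectations of nonnegative quantities are \<^typ>\<open>ennreal\<close>-valued.\<close>

definition expect :: "(real^'n \<Rightarrow> real) \<Rightarrow> (real^'n \<Rightarrow> real) \<Rightarrow> ennreal" where
  "expect p f = (\<integral>\<^sup>+x. ennreal (f x) \<partial>density lborel (\<lambda>x. ennreal (p x)))"

definition fisher_div :: "(real^'n \<Rightarrow> real) \<Rightarrow> (real^'n \<Rightarrow> real) \<Rightarrow> ennreal" where
  "fisher_div p q = expect p (\<lambda>x. (norm (score p x - score q x))\<^sup>2)"

definition chi_square_div :: "(real^'n \<Rightarrow> real) \<Rightarrow> (real^'n \<Rightarrow> real) \<Rightarrow> ennreal" where
  "chi_square_div p q = expect q (\<lambda>x. (p x / q x - 1)\<^sup>2)"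

text \<open>In the following, \<open>T\<close> is the law of the time variable (its space is the set of
  times), \<open>\<nu>\<close> the noise schedule, and \<open>M\<close>, \<open>N\<close> are laws before time-dependent noising.\<close>

definition avg_fisher ::
  "real measure \<Rightarrow> (real \<Rightarrow> real) \<Rightarrow> (real^'n) measure \<Rightarrow> (real^'n) measure \<Rightarrow> ennreal" where
  "avg_fisher T \<nu> M N = (\<integral>\<^sup>+t. fisher_div (noised M (\<nu> t)) (noised N (\<nu> t)) \<partial>T)"

definition avg_sq_dist ::
  "real measure \<Rightarrow> (real \<Rightarrow> real) \<Rightarrow> (real^'n) measure \<Rightarrow>
   (real^'n \<Rightarrow> real \<Rightarrow> real^'n) \<Rightarrow> (real^'n \<Rightarrow> real \<Rightarrow> real^'n) \<Rightarrow> ennreal" where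
  "avg_sq_dist T \<nu> M f g = (\<integral>\<^sup>+t. expect (noised M (\<nu> t)) (\<lambda>y. (norm (f y t - g y t))\<^sup>2) \<partial>T)"

definition noised_score ::
  "(real \<Rightarrow> real) \<Rightarrow> (real^'n) measure \<Rightarrow> real^'n \<Rightarrow> real \<Rightarrow> real^'n" where
  "noised_score \<nu> M y t = score (noised M (\<nu> t)) y"

text \<open>\<open>distill_loss T \<nu> A \<sigma> f\<^sub>\<phi> f\<^sub>\<psi> M\<close> is the distillation loss at a parameter whose generator
  has output law \<open>M\<close>.\<close>

definition distill_loss ::
  "real measure \<Rightarrow> (real \<Rightarrow> real) \<Rightarrow> real^'d^'m \<Rightarrow> real \<Rightarrow>
   (real^'m \<Rightarrow> real \<Rightarrow> real^'m) \<Rightarrow> (real^'m \<Rightarrow> real \<Rightarrow> real^'m) \<Rightarrow> (real^'d) measure \<Rightarrow> ennreal" where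
  "distill_loss T \<nu> A \<sigma> f\<^sub>\<phi> f\<^sub>\<psi> M = avg_sq_dist T \<nu> (corrupt A \<sigma> M) f\<^sub>\<phi> f\<^sub>\<psi>"

definition ennsqrt :: "ennreal \<Rightarrow> ennreal" where
  "ennsqrt x = (if x = \<top> then \<top> else ennreal (sqrt (enn2real x)))"

text \<open>Squared uniform-in-time score errors of \<open>f\<close> against the score of the noised law \<open>M\<close>:
  \<open>err2_sq\<close> gives $\varepsilon_{\phi,2}^2$ and $\varepsilon_\psi^2$, and \<open>err4_sq\<close> gives
  $\varepsilon_{\phi,4}^2$.\<close>

definition err2_sq ::
  "real measure \<Rightarrow> (real \<Rightarrow> real) \<Rightarrow> (real^'n) measure \<Rightarrow> (real^'n \<Rightarrow> real \<Rightarrow> real^'n) \<Rightarrow> ennreal" where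
  "err2_sq T \<nu> M f =
     (SUP t\<in>space T. expect (noised M (\<nu> t)) (\<lambda>y. (norm (f y t - noised_score \<nu> M y t))\<^sup>2))"

definition err4_sq ::
  "real measure \<Rightarrow> (real \<Rightarrow> real) \<Rightarrow> (real^'n) measure \<Rightarrow> (real^'n \<Rightarrow> real \<Rightarrow> real^'n) \<Rightarrow> ennreal" where
  "err4_sq T \<nu> M f =
     (SUP t\<in>space T. ennsqrt (expect (noised M (\<nu> t)) (\<lambda>y. (norm (f y t - noised_score \<nu> M y t)) ^ 4)))"

definition max_ratio ::
  "real measure \<Rightarrow> (real \<Rightarrow> real) \<Rightarrow> (real^'n) measure \<Rightarrow> (real^'n) measure \<Rightarrow> ennreal" where
  "max_ratio T \<nu> M N = (SUP t\<in>space T. SUP y. ennreal (noised M (\<nu> t) y / noised N (\<nu> t) y))"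

text \<open>Standing assumptions on the data: \<open>p\<^sub>X\<close> is a probability density, the generators push a
  latent law \<open>Z\<close> forward, and everything is measurable.\<close>

definition distill_setting ::
  "real measure \<Rightarrow> (real \<Rightarrow> real) \<Rightarrow> real \<Rightarrow> (real^'d \<Rightarrow> real) \<Rightarrow> 'z measure \<Rightarrow> 'p set \<Rightarrow>
   ('p \<Rightarrow> 'z \<Rightarrow> real^'d) \<Rightarrow> (real^'m \<Rightarrow> real \<Rightarrow> real^'m) \<Rightarrow> (real^'m \<Rightarrow> real \<Rightarrow> real^'m) \<Rightarrow> bool" where
  "distill_setting T \<nu> \<sigma> p\<^sub>X Z \<Theta> G f\<^sub>\<phi> f\<^sub>\<psi> \<longleftrightarrow>
     prob_space T \<and> \<nu> \<in> borel_measurable T \<and> (\<forall>t\<in>space T. 0 < \<nu> t) \<and> 0 < \<sigma> \<and>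
     p\<^sub>X \<in> borel_measurable borel \<and> (\<forall>x. 0 \<le> p\<^sub>X x) \<and>
     prob_space (density lborel (\<lambda>x. ennreal (p\<^sub>X x))) \<and>
     prob_space Z \<and> (\<forall>\<theta>\<in>\<Theta>. G \<theta> \<in> measurable Z borel) \<and>
     (\<lambda>(y, t). f\<^sub>\<phi> y t) \<in> borel_measurable (borel \<Otimes>\<^sub>M T) \<and>
     (\<lambda>(y, t). f\<^sub>\<psi> y t) \<in> borel_measurable (borel \<Otimes>\<^sub>M T)"

end

theory Submission
  imports Defs
begin

text \<open>Let \<open>p\<close>, \<open>q\<close> be the noised laws at a fixed time. Splitting the score difference along
  \<open>f\<^sub>\<phi>\<close> and \<open>f\<^sub>\<psi>\<close> bounds the Fisher divergence \<open>F\<close> by three times the sum of the distillation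
  discrepancy, the fake error and the teacher error, all under \<open>p\<close>. Moving the teacher error \<open>u\<close>
  from \<open>p\<close> to \<open>q\<close> costs the integral of \<open>\<bar>p/q - 1\<bar> u\<^sup>2\<close> against \<open>q\<close>. By Young's inequality this
  is at most a fourth moment of \<open>u\<close> plus a small multiple of the chi-square divergence, and the
  latter is at most \<open>(D/l) F\<close> by the Poincare hypothesis, because the gradient of \<open>p/q\<close> is
  \<open>p/q\<close> times the score difference and \<open>p/q \<le> D\<close>. The weight in Young's inequality is chosen so that
  half of \<open>F\<close> is absorbed, which is legitimate since \<open>p/q \<le> D\<close> already shows that \<open>F\<close> is finite.
  As this happens at each time separately, averaging over time needs no Jensen inequality.\<close>

section \<open>Corrupted and noised laws: total mass and measurability\<close>

lemma prob_space_convolution_gaussian: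
  fixes M :: "(real^'n) measure"
  assumes "prob_space M" "sets M = sets borel" "0 < s"
  shows "prob_space (M \<star> gaussian s)"
proof
  interpret M: prob_space M by fact
  interpret N: prob_space "gaussian s :: (real^'n) measure" by (rule prob_space_gaussian) fact
  have "emeasure (M \<star> gaussian s) UNIV = (\<integral>\<^sup>+y. \<integral>\<^sup>+z. indicator UNIV (y + z) \<partial>gaussian s \<partial>M)"
    by (rule convolution_emeasure')
      (use assms in \<open>auto simp: gaussian_def M.finite_measure_axioms N.finite_measure_axioms[unfolded gaussian_def]\<close>)
  also have "\<dots> = 1"
    using M.emeasure_space_1 N.emeasure_space_1 by simp
  finally show "emeasure (M \<star> gaussian s) (space (M \<star> gaussian s)) = 1" by simp
qed

lemma sets_corrupt [simp]: "sets (corrupt A \<sigma> M) = sets borel"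
  by (simp add: corrupt_def)

lemma prob_space_corrupt:
  assumes "prob_space M" "sets M = sets borel" "0 < \<sigma>"
  shows "prob_space (corrupt A \<sigma> M)"
proof -
  have "(\<lambda>x. A *v x) \<in> measurable M borel"
    using assms(2) borel_measurable_continuous_onI[of "(*v) A"] matrix_vector_mult_linear_continuous_on
    by (metis measurable_cong_sets)
  then show ?thesis
    unfolding corrupt_def
    by (intro prob_space_convolution_gaussian prob_space.prob_space_distr assms) auto
qed

lemma noised_measurable [measurable]:
  assumes "prob_space M" "sets M = sets borel" "0 < s"
  shows "noised M s \<in> borel_measurable borel"
proof -
  interpret prob_space M by fact
  note [measurable_cong] = assms(2)
  show ?thesis unfolding noised_def[abs_def] by measurable
qed

text \<open>Joint measurability in time and space is what makes expectations under the noised law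
  measurable functions of time.\<close>

lemma noised_schedule_measurable:
  assumes "prob_space M" "sets M = sets borel" "\<nu> \<in> borel_measurable T"
  shows "(\<lambda>(t, x). noised M (\<nu> t) x) \<in> borel_measurable (T \<Otimes>\<^sub>M borel)"
proof -
  interpret prob_space M by fact
  note [measurable_cong] = assms(2)
  note [measurable] = assms(3)
  have [measurable]: "(\<lambda>x :: real^'n. x $ i) \<in> borel_measurable borel" for i
    by (intro borel_measurable_continuous_onI continuous_intros)
  \<comment> \<open>The standard deviation varies with time, so measurability of
    \<open>gauss_density s\<close> for fixed \<open>s\<close> does not suffice and the density is
    unfolded into its formula.\<close>
  have "(\<lambda>z. gauss_density (\<nu> (fst (fst z))) (snd (fst z) - snd z))
      \<in> borel_measurable ((T \<Otimes>\<^sub>M borel) \<Otimes>\<^sub>M M)"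
    unfolding gauss_density_def normal_density_def by measurable
  then show ?thesis unfolding noised_def split_beta' by measurable
qed

section \<open>Scores of noised laws\<close>

lemma score_noised:
  assumes "prob_space M" "sets M = sets borel" "0 < s"
  shows "score (noised M s) x =
    (1 / noised M s x) *\<^sub>R (\<integral>y. (- gauss_density s (x - y) / s\<^sup>2) *\<^sub>R (x - y) \<partial>M)"
  unfolding score_def
  by (intro grad_eq GDERIV_DERIV_compose[OF noised_gderiv[OF assms]])
    (use noised_pos[OF assms, of x] in \<open>auto intro!: derivative_eq_intros simp: divide_inverse\<close>)

lemma gderiv_noised_score:
  assumes "prob_space M" "sets M = sets borel" "0 < s"
  shows "GDERIV (noised M s) x :> noised M s x *\<^sub>R score (noised M s) x"
  using noised_gderiv[OF assms, of x] noised_pos[OF assms, of x]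
  by (simp add: score_noised[OF assms])

text \<open>The closed form in \<open>score_noised\<close> is essential here: it replaces the
  definite description in \<open>grad\<close>, from which measurability cannot be read off, by a
  parameter integral.\<close>

lemma score_noised_measurable:
  assumes "prob_space M" "sets M = sets borel" "0 < s"
  shows "score (noised M s) \<in> borel_measurable borel"
proof -
  interpret prob_space M by fact
  note [measurable_cong] = assms(2)
  note [measurable] = noised_measurable[OF assms]
  show ?thesis unfolding score_noised[OF assms, abs_def] by measurable
qed

text \<open>Quotient rule, with each gradient written as density times score. This connects the
  Dirichlet energy in the Poincare hypothesis with the Fisher divergence.\<close>

lemma grad_ratio_noised:
  assumes P: "prob_space P" "sets P = sets borel" and Q: "prob_space Q" "sets Q = sets borel"
    and s: "0 < s"
  shows "grad (\<lambda>z. noised P s z / noised Q s z) y =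
    (noised P s y / noised Q s y) *\<^sub>R (score (noised P s) y - score (noised Q s) y)"
proof (rule grad_eq)
  let ?p = "noised P s" and ?q = "noised Q s"
  have q: "0 < ?q y" by (rule noised_pos[OF Q s])
  have "GDERIV (\<lambda>z. ?p z * inverse (?q z)) y :>
      ?p y *\<^sub>R (- (inverse (?q y))\<^sup>2 *\<^sub>R (?q y *\<^sub>R score ?q y))
      + inverse (?q y) *\<^sub>R (?p y *\<^sub>R score ?p y)"
    using q by (intro GDERIV_mult GDERIV_inverse gderiv_noised_score P Q s) auto
  moreover have "?p y *\<^sub>R (- (inverse (?q y))\<^sup>2 *\<^sub>R (?q y *\<^sub>R score ?q y))
      + inverse (?q y) *\<^sub>R (?p y *\<^sub>R score ?p y) = (?p y / ?q y) *\<^sub>R (score ?p y - score ?q y)"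
    using q by (simp add: power2_eq_square field_simps scaleR_diff_right)
  ultimately show "GDERIV (\<lambda>z. ?p z / ?q z) y :> (?p y / ?q y) *\<^sub>R (score ?p y - score ?q y)"
    by (simp add: divide_inverse)
qed

section \<open>Calculus of expectations and elementary inequalities\<close>

lemma expect_eq:
  assumes "p \<in> borel_measurable borel" "f \<in> borel_measurable borel" "\<And>x. 0 \<le> p x"
  shows "expect p f = (\<integral>\<^sup>+x. ennreal (p x * f x) \<partial>lborel)"
  unfolding expect_def using assms by (subst nn_integral_density) (auto simp: ennreal_mult')

lemma expect_cmult:
  assumes "f \<in> borel_measurable borel" "0 \<le> c"
  shows "expect p (\<lambda>x. c * f x) = ennreal c * expect p f"
  unfolding expect_def using assms by (simp add: ennreal_mult' nn_integral_cmult)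

lemma expect_add:
  assumes "f \<in> borel_measurable borel" "g \<in> borel_measurable borel" "\<And>x. 0 \<le> f x" "\<And>x. 0 \<le> g x"
  shows "expect p (\<lambda>x. f x + g x) = expect p f + expect p g"
  unfolding expect_def using assms by (simp add: nn_integral_add)

lemma expect_mono:
  assumes "\<And>x. f x \<le> g x"
  shows "expect p f \<le> expect p g"
  unfolding expect_def by (intro nn_integral_mono ennreal_leI assms)

text \<open>The gap between the two sides is the sum of the three squared pairwise
  distances.\<close>

lemma norm_add3_sq_le:
  fixes a b c :: "'a :: real_inner"
  shows "(norm (a + b + c))\<^sup>2 \<le> 3 * ((norm a)\<^sup>2 + (norm b)\<^sup>2 + (norm c)\<^sup>2)"
proof -
  have "0 \<le> (norm (a - b))\<^sup>2 + (norm (b - c))\<^sup>2 + (norm (a - c))\<^sup>2" by simp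
  then show ?thesis
    unfolding power2_norm_eq_inner by (simp add: algebra_simps inner_commute)
qed

text \<open>Absorption step. Finiteness of \<open>x\<close> is essential, since an infinite
  \<open>x\<close> satisfies the first assumption for every \<open>y\<close>.\<close>

lemma ennreal_le_half_self_add:
  fixes x y :: ennreal
  assumes "x \<le> y + ennreal (1/2) * x" "x < \<top>"
  shows "x \<le> 2 * y"
proof (cases y)
  case (real r)
  from assms(2) obtain z where z: "x = ennreal z" "0 \<le> z" by (cases x) auto
  have "ennreal z \<le> ennreal (r + 1/2 * z)"
    using assms(1) real z ennreal_mult'[of "1/2" z] by simp
  then have "z \<le> r + 1/2 * z" using real z by (subst (asm) ennreal_le_iff) auto
  then have "z \<le> 2 * r" by simp
  then have "ennreal z \<le> ennreal (2 * r)" by (rule ennreal_leI)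
  then show ?thesis using real z by (simp add: ennreal_mult')
qed (simp add: ennreal_mult_top)

section \<open>Estimates at a fixed time\<close>

lemma expect_change_of_density_le:
  fixes u :: "real^'n \<Rightarrow> real^'n"
  assumes [measurable]: "p \<in> borel_measurable borel" "q \<in> borel_measurable borel" "u \<in> borel_measurable borel"
    and p: "\<And>x. 0 \<le> p x" and q: "\<And>x. 0 < q x" and a: "0 < a"
  shows "expect p (\<lambda>y. (norm (u y))\<^sup>2) \<le> expect q (\<lambda>y. (norm (u y))\<^sup>2)
    + ennreal (a / 2) * chi_square_div p q + ennreal (1 / (2 * a)) * expect q (\<lambda>y. norm (u y) ^ 4)"
proof -
  have "expect p (\<lambda>y. (norm (u y))\<^sup>2) = (\<integral>\<^sup>+x. ennreal (p x * (norm (u x))\<^sup>2) \<partial>lborel)"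
    by (rule expect_eq) (use p in auto)
  also have "\<dots> \<le> (\<integral>\<^sup>+x. ennreal (q x * ((norm (u x))\<^sup>2 + a / 2 * (p x / q x - 1)\<^sup>2 + 1 / (2 * a) * norm (u x) ^ 4)) \<partial>lborel)"
  proof (intro nn_integral_mono ennreal_leI)
    fix x
    define r n where "r = p x / q x" and "n = (norm (u x))\<^sup>2"
    \<comment> \<open>Expanding this square gives Young's inequality with weight \<open>a\<close>
      for the product in \<open>r * n = n + (r - 1) * n\<close>.\<close>
    have "0 \<le> (a * (r - 1) - n)\<^sup>2 / (2 * a)" using a by simp
    then have "(r - 1) * n \<le> a / 2 * (r - 1)\<^sup>2 + 1 / (2 * a) * n\<^sup>2"
      using a by (simp add: power2_eq_square field_simps)
    then have "r * n \<le> n + a / 2 * (r - 1)\<^sup>2 + 1 / (2 * a) * n\<^sup>2"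
      by (simp add: algebra_simps)
    then have "q x * (r * n) \<le> q x * (n + a / 2 * (r - 1)\<^sup>2 + 1 / (2 * a) * n\<^sup>2)"
      using q[of x] by (intro mult_left_mono) auto
    moreover have "q x * (r * n) = p x * n" using q[of x] by (simp add: r_def)
    ultimately show "p x * (norm (u x))\<^sup>2 \<le>
        q x * ((norm (u x))\<^sup>2 + a / 2 * (p x / q x - 1)\<^sup>2 + 1 / (2 * a) * norm (u x) ^ 4)"
      by (simp add: r_def n_def power_mult[symmetric])
  qed
  also have "\<dots> = expect q (\<lambda>x. (norm (u x))\<^sup>2 + a / 2 * (p x / q x - 1)\<^sup>2 + 1 / (2 * a) * norm (u x) ^ 4)"
    by (rule expect_eq[symmetric]) (use q in \<open>auto intro: less_imp_le\<close>)
  also have "\<dots> = expect q (\<lambda>y. (norm (u y))\<^sup>2)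
    + ennreal (a / 2) * chi_square_div p q + ennreal (1 / (2 * a)) * expect q (\<lambda>y. norm (u y) ^ 4)"
    unfolding chi_square_div_def using a
    by (simp add: expect_add expect_cmult del: times_divide_eq_left)
  finally show ?thesis .
qed

text \<open>A crude comparison, used to see that the Fisher divergence is finite before part of it
  is absorbed.\<close>

lemma expect_ratio_le:
  assumes [measurable]: "p \<in> borel_measurable borel" "q \<in> borel_measurable borel" "f \<in> borel_measurable borel"
    and p: "\<And>x. 0 \<le> p x" and q: "\<And>x. 0 < q x" and f: "\<And>x. 0 \<le> f x"
    and D: "\<And>x. p x / q x \<le> D" "0 \<le> D"
  shows "expect p f \<le> ennreal D * expect q f"
proof -
  have "expect p f = (\<integral>\<^sup>+x. ennreal (p x * f x) \<partial>lborel)"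
    by (rule expect_eq) (use p in auto)
  also have "\<dots> \<le> (\<integral>\<^sup>+x. ennreal (q x * (D * f x)) \<partial>lborel)"
  proof (intro nn_integral_mono ennreal_leI)
    fix x
    have "p x \<le> D * q x" using D(1)[of x] q[of x] by (simp add: divide_le_eq)
    then have "p x * f x \<le> D * q x * f x" by (intro mult_right_mono f)
    then show "p x * f x \<le> q x * (D * f x)" by (simp add: mult_ac)
  qed
  also have "\<dots> = expect q (\<lambda>x. D * f x)"
    by (rule expect_eq[symmetric]) (use q in \<open>auto intro: less_imp_le\<close>)
  also have "\<dots> = ennreal D * expect q f" by (rule expect_cmult) (use D in auto)
  finally show ?thesis .
qed

text \<open>The squared gradient of \<open>p / q\<close> carries the factor
  \<open>(p / q)\<^sup>2\<close>. Against \<open>q\<close>, one factor \<open>p / q\<close> turns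
  the weight into \<open>p\<close>, and the other is at most \<open>D\<close>.\<close>

lemma dirichlet_ratio_le_fisher:
  fixes P Q :: "(real^'n) measure"
  assumes P: "prob_space P" "sets P = sets borel" and Q: "prob_space Q" "sets Q = sets borel"
    and s: "0 < s" and D: "\<And>y. noised P s y / noised Q s y \<le> D" "0 \<le> D"
  shows "expect (noised Q s) (\<lambda>y. (norm (grad (\<lambda>z. noised P s z / noised Q s z) y))\<^sup>2)
    \<le> ennreal D * fisher_div (noised P s) (noised Q s)"
proof -
  let ?p = "noised P s" and ?q = "noised Q s"
  let ?h = "\<lambda>y. (norm (score ?p y - score ?q y))\<^sup>2"
  note [measurable] = noised_measurable[OF P s] noised_measurable[OF Q s]
    score_noised_measurable[OF P s] score_noised_measurable[OF Q s]
  have p: "0 < ?p y" and q: "0 < ?q y" for y by (intro noised_pos P Q s)+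
  have "expect ?q (\<lambda>y. (norm (grad (\<lambda>z. ?p z / ?q z) y))\<^sup>2)
      = expect ?q (\<lambda>y. (?p y / ?q y)\<^sup>2 * ?h y)"
    by (simp add: grad_ratio_noised[OF P Q s] power_mult_distrib power_divide)
  also have "\<dots> = (\<integral>\<^sup>+x. ennreal (?q x * ((?p x / ?q x)\<^sup>2 * ?h x)) \<partial>lborel)"
    by (rule expect_eq) (use q in \<open>auto intro: less_imp_le\<close>)
  also have "\<dots> \<le> (\<integral>\<^sup>+x. ennreal (?p x * (D * ?h x)) \<partial>lborel)"
  proof (intro nn_integral_mono ennreal_leI)
    fix x
    have "?q x * ((?p x / ?q x)\<^sup>2 * ?h x) = ?p x / ?q x * (?p x * ?h x)"
      using q[of x] by (simp add: power2_eq_square)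
    also have "\<dots> \<le> D * (?p x * ?h x)"
      by (intro mult_right_mono D) (use p[of x] in auto)
    finally show "?q x * ((?p x / ?q x)\<^sup>2 * ?h x) \<le> ?p x * (D * ?h x)" by (simp add: mult_ac)
  qed
  also have "\<dots> = expect ?p (\<lambda>x. D * ?h x)"
    by (rule expect_eq[symmetric]) (use p in \<open>auto intro: less_imp_le\<close>)
  also have "\<dots> = ennreal D * fisher_div ?p ?q"
    unfolding fisher_div_def by (rule expect_cmult) (use D in auto)
  finally show ?thesis .
qed

lemma fisher_noised_le:
  fixes P Q :: "(real^'n) measure" and f g :: "real^'n \<Rightarrow> real^'n"
  assumes P: "prob_space P" "sets P = sets borel" and Q: "prob_space Q" "sets Q = sets borel"
    and s: "0 < s" and [measurable]: "f \<in> borel_measurable borel" "g \<in> borel_measurable borel"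
    and D: "\<And>y. noised P s y / noised Q s y \<le> D" "0 < D" and l: "0 < l"
    and poincare: "chi_square_div (noised P s) (noised Q s) \<le> ennreal (1 / l) *
      expect (noised Q s) (\<lambda>y. (norm (grad (\<lambda>z. noised P s z / noised Q s z) y))\<^sup>2)"
  shows "fisher_div (noised P s) (noised Q s) \<le>
    6 * (expect (noised P s) (\<lambda>y. (norm (f y - g y))\<^sup>2)
       + expect (noised Q s) (\<lambda>y. (norm (f y - score (noised Q s) y))\<^sup>2)
       + expect (noised P s) (\<lambda>y. (norm (g y - score (noised P s) y))\<^sup>2))
    + 9 * ennreal (D / l) * expect (noised Q s) (\<lambda>y. norm (f y - score (noised Q s) y) ^ 4)"
    (is "?F \<le> 6 * (?A + ?E2 + ?E\<psi>) + 9 * _ * ?E4")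
proof -
  let ?p = "noised P s" and ?q = "noised Q s"
  let ?u = "\<lambda>y. f y - score ?q y" and ?v = "\<lambda>y. g y - score ?p y"
  note [measurable] = noised_measurable[OF P s] noised_measurable[OF Q s]
    score_noised_measurable[OF P s] score_noised_measurable[OF Q s]
  have p: "0 < ?p y" and q: "0 < ?q y" for y by (intro noised_pos P Q s)+
  let ?B = "expect ?p (\<lambda>y. (norm (?u y))\<^sup>2)"
  \<comment> \<open>With this weight, \<open>a / 2\<close> times the factor \<open>D / l\<close>
    from the Poincare hypothesis is 1/6, which becomes 1/2 after the factor 3 from splitting the
    score difference.\<close>
  define a where "a = l / (3 * D)"
  have a: "0 < a" using l D by (simp add: a_def)
  have "?F \<le> expect ?p (\<lambda>y. 3 * ((norm (f y - g y))\<^sup>2 + (norm (?u y))\<^sup>2 + (norm (?v y))\<^sup>2))"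
    unfolding fisher_div_def
  proof (rule expect_mono)
    fix y
    have "score ?p y - score ?q y = - (f y - g y) + ?u y + - ?v y" by simp
    then show "(norm (score ?p y - score ?q y))\<^sup>2
        \<le> 3 * ((norm (f y - g y))\<^sup>2 + (norm (?u y))\<^sup>2 + (norm (?v y))\<^sup>2)"
      using norm_add3_sq_le[of "- (f y - g y)" "?u y" "- ?v y"] by (simp only: norm_minus_cancel)
  qed
  also have "\<dots> = 3 * (?A + ?B + ?E\<psi>)"
    by (subst expect_cmult, simp, simp, (subst expect_add, simp_all)+)
  finally have F: "?F \<le> 3 * (?A + ?B + ?E\<psi>)" .
  have B: "?B \<le> ennreal D * ?E2"
    by (rule expect_ratio_le) (use p q D in \<open>auto intro: less_imp_le\<close>)
  have "chi_square_div ?p ?q \<le> ennreal (1 / l) * (ennreal D * ?F)"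
    using poincare dirichlet_ratio_le_fisher[OF P Q s D(1)] D(2)
    by (meson less_imp_le mult_left_mono order_trans zero_le)
  then have "ennreal (a / 2) * chi_square_div ?p ?q \<le> ennreal (a / 2) * (ennreal (1 / l) * (ennreal D * ?F))"
    by (rule mult_left_mono) simp
  also have "\<dots> = ennreal (1 / 6) * ?F"
    using a l D by (simp add: mult.assoc[symmetric] ennreal_mult'[symmetric]) (simp add: a_def)
  finally have chi: "ennreal (a / 2) * chi_square_div ?p ?q \<le> ennreal (1 / 6) * ?F" .
  have "?B \<le> ?E2 + ennreal (a / 2) * chi_square_div ?p ?q + ennreal (1 / (2 * a)) * ?E4"
    by (rule expect_change_of_density_le) (use p q a in \<open>auto intro: less_imp_le\<close>)
  also have "\<dots> \<le> ?E2 + ennreal (1 / 6) * ?F + ennreal (1 / (2 * a)) * ?E4"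
    by (intro add_mono chi order_refl)
  finally have "3 * (?A + ?B + ?E\<psi>) \<le> 3 * (?A + (?E2 + ennreal (1 / 6) * ?F + ennreal (1 / (2 * a)) * ?E4) + ?E\<psi>)"
    by (intro mult_left_mono add_mono order_refl) simp_all
  also have "\<dots> = 3 * (?A + ?E2 + ?E\<psi>) + (3 * ennreal (1 / (2 * a))) * ?E4 + (3 * ennreal (1 / 6)) * ?F"
    by (simp add: distrib_left mult_ac add_ac)
  also have "3 * ennreal (1 / 6) = ennreal (1 / 2)"
    using ennreal_mult'[of 3 "1 / 6"] by simp
  finally have half: "?F \<le> 3 * (?A + ?E2 + ?E\<psi>) + (3 * ennreal (1 / (2 * a))) * ?E4 + ennreal (1 / 2) * ?F"
    using F by (rule order_trans[rotated])
  \<comment> \<open>The Young weight \<open>1 / (2 * a)\<close> equals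
    \<open>3 * D / (2 * l)\<close>; the factors 3 from the splitting and 2 from the absorption turn
    it into \<open>9 * D / l\<close>.\<close>
  have c: "2 * (3 * ennreal (1 / (2 * a))) = 9 * ennreal (D / l)"
  proof -
    have "2 * (3 * ennreal (1 / (2 * a))) = ennreal (6 * (1 / (2 * a)))"
      using ennreal_mult'[of 6 "1 / (2 * a)"] by (simp add: mult.assoc[symmetric])
    also have "6 * (1 / (2 * a)) = 9 * (D / l)" using l D by (simp add: a_def)
    finally show ?thesis using ennreal_mult'[of 9 "D / l"] by simp
  qed
  show ?thesis
  \<comment> \<open>If this sum is infinite, so is the claimed bound. Otherwise the crude bound
    \<open>B\<close> makes \<open>?F\<close> finite and the absorption applies.\<close>
  proof (cases "?A + ?E2 + ?E\<psi> = \<top>")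
    case False
    have "?F < \<top>"
    proof -
      have "ennreal D * ?E2 < \<top>" using False by (simp add: ennreal_mult_less_top less_top)
      then have "?B < \<top>" using B by (rule order_le_less_trans[rotated])
      then have "3 * (?A + ?B + ?E\<psi>) < \<top>"
        using False by (simp add: ennreal_mult_less_top less_top)
      then show ?thesis using F by (rule order_le_less_trans[rotated])
    qed
    from ennreal_le_half_self_add[OF half this]
    have "?F \<le> 2 * (3 * (?A + ?E2 + ?E\<psi>)) + 2 * (3 * ennreal (1 / (2 * a))) * ?E4"
      by (simp only: distrib_left mult.assoc)
    then show ?thesis unfolding c by (simp only: mult.assoc[symmetric]) simp
  next
    case True
    then have *: "6 * (?A + ?E2 + ?E\<psi>) = \<top>" by (simp only: ennreal_mult_eq_top_iff) simp
    show ?thesis by (subst *) simp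
  qed
qed

section \<open>Uniform errors and averaging over time\<close>

lemma expect_noised_measurable:
  fixes f g :: "real^'n \<Rightarrow> 't \<Rightarrow> real^'m" and M :: "(real^'n) measure"
  assumes M: "prob_space M" "sets M = sets borel" and \<nu>: "\<nu> \<in> borel_measurable T"
    and f: "(\<lambda>(y, t). f y t) \<in> borel_measurable (borel \<Otimes>\<^sub>M T)"
    and g: "(\<lambda>(y, t). g y t) \<in> borel_measurable (borel \<Otimes>\<^sub>M T)"
  shows "(\<lambda>t. expect (noised M (\<nu> t)) (\<lambda>y. (norm (f y t - g y t))\<^sup>2)) \<in> borel_measurable T"
proof -
  note [measurable] = noised_schedule_measurable[OF M \<nu>] f g
  \<comment> \<open>The rewriting is restricted to \<open>space T\<close>, because it relies on
    measurability of the sections in \<open>y\<close>, which joint measurability yields only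
    there.\<close>
  have eq: "expect (noised M (\<nu> t)) (\<lambda>y. (norm (f y t - g y t))\<^sup>2) =
    (\<integral>\<^sup>+y. ennreal (noised M (\<nu> t) y) * ennreal ((norm (f y t - g y t))\<^sup>2) \<partial>lborel)" if "t \<in> space T" for t
  proof -
    have [measurable]: "noised M (\<nu> t) \<in> borel_measurable borel"
      using measurable_compose[OF measurable_Pair1'[OF that] noised_schedule_measurable[OF M \<nu>]] by simp
    have "(\<lambda>y. f y t) \<in> borel_measurable borel" "(\<lambda>y. g y t) \<in> borel_measurable borel"
      using measurable_compose[OF measurable_Pair2'[OF that] f]
        measurable_compose[OF measurable_Pair2'[OF that] g] by simp_all
    from borel_measurable_diff[OF this]
    have [measurable]: "(\<lambda>y. (norm (f y t - g y t))\<^sup>2) \<in> borel_measurable borel"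
      by (intro borel_measurable_power) (rule measurable_compose[OF _ borel_measurable_norm])
    show ?thesis unfolding expect_def by (subst nn_integral_density) simp_all
  qed
  show ?thesis by (subst measurable_cong[OF eq]) measurable
qed

lemma ennsqrt_power2: "(ennsqrt x)\<^sup>2 = x"
  by (cases x) (auto simp: ennsqrt_def ennreal_power)

lemma expect_le_err2_sq:
  assumes "t \<in> space T"
  shows "expect (noised M (\<nu> t)) (\<lambda>y. (norm (f y t - score (noised M (\<nu> t)) y))\<^sup>2) \<le> err2_sq T \<nu> M f"
  unfolding err2_sq_def noised_score_def by (rule SUP_upper[OF assms])

text \<open>\<open>err4_sq\<close> is a supremum of square roots, so its square is what compares
  with a fourth moment.\<close>

lemma expect_le_err4_sq_power2:
  assumes "t \<in> space T"
  shows "expect (noised M (\<nu> t)) (\<lambda>y. norm (f y t - score (noised M (\<nu> t)) y) ^ 4) \<le> (err4_sq T \<nu> M f)\<^sup>2"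
proof -
  let ?E = "expect (noised M (\<nu> t)) (\<lambda>y. norm (f y t - score (noised M (\<nu> t)) y) ^ 4)"
  have "ennsqrt ?E \<le> err4_sq T \<nu> M f"
    unfolding err4_sq_def noised_score_def by (rule SUP_upper2[OF assms]) simp
  then show ?thesis by (metis ennsqrt_power2 power_mono zero_le)
qed

text \<open>Finiteness matters because \<open>enn2real\<close> sends infinity to 0.\<close>

lemma ratio_le_max_ratio:
  assumes "t \<in> space T" "max_ratio T \<nu> M N < \<top>"
  shows "noised M (\<nu> t) y / noised N (\<nu> t) y \<le> enn2real (max_ratio T \<nu> M N)"
proof -
  have "ennreal (noised M (\<nu> t) y / noised N (\<nu> t) y) \<le> max_ratio T \<nu> M N"
    unfolding max_ratio_def by (rule SUP_upper2[OF assms(1)]) (rule SUP_upper, simp)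
  also have "\<dots> = ennreal (enn2real (max_ratio T \<nu> M N))" using assms(2) by simp
  finally show ?thesis by (simp add: ennreal_le_iff)
qed

lemma avg_fisher_le:
  fixes P Q :: "(real^'n) measure"
  assumes T: "prob_space T" and \<nu>: "\<nu> \<in> borel_measurable T" "\<And>t. t \<in> space T \<Longrightarrow> 0 < \<nu> t"
    and P: "prob_space P" "sets P = sets borel" and Q: "prob_space Q" "sets Q = sets borel"
    and f: "(\<lambda>(y, t). f y t) \<in> borel_measurable (borel \<Otimes>\<^sub>M T)"
    and g: "(\<lambda>(y, t). g y t) \<in> borel_measurable (borel \<Otimes>\<^sub>M T)"
    and \<Delta>: "max_ratio T \<nu> P Q < \<top>" and l: "0 < l"
    and poincare: "\<And>t. t \<in> space T \<Longrightarrow> chi_square_div (noised P (\<nu> t)) (noised Q (\<nu> t)) \<le>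
      ennreal (1 / l) * expect (noised Q (\<nu> t))
        (\<lambda>y. (norm (grad (\<lambda>z. noised P (\<nu> t) z / noised Q (\<nu> t) z) y))\<^sup>2)"
  shows "avg_fisher T \<nu> P Q \<le> 6 * (avg_sq_dist T \<nu> P f g + err2_sq T \<nu> Q f + err2_sq T \<nu> P g)
    + 9 * (max_ratio T \<nu> P Q / ennreal l) * (err4_sq T \<nu> Q f)\<^sup>2"
proof -
  interpret T: prob_space T by fact
  define D where "D = enn2real (max_ratio T \<nu> P Q)"
  let ?A = "\<lambda>t. expect (noised P (\<nu> t)) (\<lambda>y. (norm (f y t - g y t))\<^sup>2)"
  have D_le: "noised P (\<nu> t) y / noised Q (\<nu> t) y \<le> D" if "t \<in> space T" for t y
    unfolding D_def by (rule ratio_le_max_ratio[OF that \<Delta>])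
  \<comment> \<open>Any single time shows \<open>D\<close> to be positive, as noised densities are
    positive everywhere; the weight in the fixed-time estimate divides by \<open>D\<close>.\<close>
  obtain t0 where t0: "t0 \<in> space T" using T.not_empty by blast
  have "0 < noised P (\<nu> t0) 0 / noised Q (\<nu> t0) 0"
    by (intro divide_pos_pos noised_pos P Q \<nu> t0)
  then have D_pos: "0 < D" using D_le[OF t0, of 0] by linarith
  have D_eq: "max_ratio T \<nu> P Q / ennreal l = ennreal (D / l)"
  proof -
    have "max_ratio T \<nu> P Q = ennreal D" using \<Delta> by (simp add: D_def)
    then show ?thesis using D_pos l by (simp add: divide_ennreal)
  qed
  note A_meas = expect_noised_measurable[OF P \<nu>(1) f g]
  let ?c = "9 * ennreal (D / l) * (err4_sq T \<nu> Q f)\<^sup>2"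
  \<comment> \<open>Once the errors are replaced by their suprema over time, only the discrepancy
    \<open>?A t\<close> depends on \<open>t\<close>, and the constants integrate to themselves. The
    Fisher divergence enters through monotonicity alone, so measurability in time is required only
    of \<open>?A\<close>.\<close>
  have "avg_fisher T \<nu> P Q \<le> (\<integral>\<^sup>+t. 6 * (?A t + err2_sq T \<nu> Q f + err2_sq T \<nu> P g) + ?c \<partial>T)"
    unfolding avg_fisher_def
  proof (intro nn_integral_mono)
    fix t assume t: "t \<in> space T"
    have [measurable]: "(\<lambda>y. f y t) \<in> borel_measurable borel" "(\<lambda>y. g y t) \<in> borel_measurable borel"
      using measurable_compose[OF measurable_Pair2'[OF t] f]
        measurable_compose[OF measurable_Pair2'[OF t] g] by simp_all
    note fisher_noised_le[OF P Q \<nu>(2)[OF t], of "\<lambda>y. f y t" "\<lambda>y. g y t" D l,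
        OF _ _ D_le[OF t] D_pos l poincare[OF t]]
    also have "6 * (?A t + expect (noised Q (\<nu> t)) (\<lambda>y. (norm (f y t - score (noised Q (\<nu> t)) y))\<^sup>2)
       + expect (noised P (\<nu> t)) (\<lambda>y. (norm (g y t - score (noised P (\<nu> t)) y))\<^sup>2))
       + 9 * ennreal (D / l) * expect (noised Q (\<nu> t)) (\<lambda>y. norm (f y t - score (noised Q (\<nu> t)) y) ^ 4)
       \<le> 6 * (?A t + err2_sq T \<nu> Q f + err2_sq T \<nu> P g) + ?c"
      by (intro add_mono mult_left_mono expect_le_err2_sq expect_le_err4_sq_power2 order_refl t) auto
    finally show "fisher_div (noised P (\<nu> t)) (noised Q (\<nu> t))
        \<le> 6 * (?A t + err2_sq T \<nu> Q f + err2_sq T \<nu> P g) + ?c"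
      by simp
  qed
  also have "\<dots> = 6 * (avg_sq_dist T \<nu> P f g + err2_sq T \<nu> Q f + err2_sq T \<nu> P g) + ?c"
    unfolding avg_sq_dist_def using A_meas
    by (simp add: nn_integral_add nn_integral_cmult T.emeasure_space_1)
  finally show ?thesis unfolding D_eq .
qed

section \<open>Use of near-optimality and final constants\<close>

lemma avg_sq_dist_noised_score_le:
  assumes "prob_space T"
  shows "avg_sq_dist T \<nu> M f (noised_score \<nu> M) \<le> err2_sq T \<nu> M f"
proof -
  interpret prob_space T by fact
  have "avg_sq_dist T \<nu> M f (noised_score \<nu> M) \<le> (\<integral>\<^sup>+t. err2_sq T \<nu> M f \<partial>T)"
    unfolding avg_sq_dist_def noised_score_def by (intro nn_integral_mono expect_le_err2_sq)
  then show ?thesis by (simp add: emeasure_space_1)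
qed

text \<open>The constant 12 comes from \<open>a\<close> occurring twice with factor 6; all other
  coefficients are smaller. The square of the root is its argument, and the nonnegative term
  \<open>e * x\<close> can only increase the right-hand side.\<close>

lemma distill_bound_arith:
  fixes a b c d e :: ennreal
  shows "6 * ((a + d) + a + b) + 9 * c * e\<^sup>2 \<le> 12 * (e * x + ennsqrt (e\<^sup>2 * c + a + b + d))\<^sup>2"
proof -
  have "6 * ((a + d) + a + b) + 9 * c * e\<^sup>2 \<le> 12 * (a + b + d) + 12 * (e\<^sup>2 * c)"
  proof (rule add_mono)
    have "6 * ((a + d) + a + b) \<le> 6 * ((a + d) + a + b) + 6 * (b + d)" by simp
    also have "\<dots> = 12 * (a + b + d)"
    proof -
      have "12 * x = 6 * x + 6 * x" for x :: ennreal by (simp flip: distrib_right)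
      then show ?thesis by (simp only: distrib_left add_ac)
    qed
    finally show "6 * ((a + d) + a + b) \<le> 12 * (a + b + d)" .
    show "9 * c * e\<^sup>2 \<le> 12 * (e\<^sup>2 * c)"
      unfolding mult.assoc mult.commute[of c] by (rule mult_right_mono) simp_all
  qed
  also have "\<dots> = 12 * (ennsqrt (e\<^sup>2 * c + a + b + d))\<^sup>2"
    unfolding ennsqrt_power2 by (simp add: distrib_left add_ac)
  also have "\<dots> \<le> 12 * (e * x + ennsqrt (e\<^sup>2 * c + a + b + d))\<^sup>2"
    by (intro mult_left_mono power_mono) auto
  finally show ?thesis .
qed

lemma ennsqrt_mono: "x \<le> y \<Longrightarrow> ennsqrt x \<le> ennsqrt y"
  by (auto simp: ennsqrt_def top_unique less_top intro!: ennreal_leI enn2real_mono)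

text \<open>The distillation loss at \<open>\<theta>\<close> exceeds that at
  \<open>\<theta>'\<close> by at most \<open>\<epsilon>\<close>. As \<open>\<theta>'\<close>
  reproduces \<open>P\<^sub>Y\<close>, the latter loss is a discrepancy under
  \<open>P\<^sub>Y\<close>, which \<open>fake\<close> bounds by the averaged teacher error and hence
  by its supremum over time.\<close>

lemma avg_fisher_distilled_le:
  fixes A :: "real^'d^'m" and \<sigma> :: real and p\<^sub>X :: "real^'d \<Rightarrow> real"
    and Z :: "'z measure" and G :: "'p \<Rightarrow> 'z \<Rightarrow> real^'d"
    and f\<^sub>\<phi> f\<^sub>\<psi> :: "real^'m \<Rightarrow> real \<Rightarrow> real^'m"
  defines "P\<^sub>Y \<equiv> corrupt A \<sigma> (density lborel (\<lambda>x. ennreal (p\<^sub>X x)))"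
    and "P \<equiv> \<lambda>\<theta>. distr Z borel (G \<theta>)"
  assumes setting: "distill_setting T \<nu> \<sigma> p\<^sub>X Z \<Theta> G f\<^sub>\<phi> f\<^sub>\<psi>" and \<theta>: "\<theta> \<in> \<Theta>"
    and \<Delta>: "max_ratio T \<nu> (corrupt A \<sigma> (P \<theta>)) P\<^sub>Y < \<top>" and l: "0 < l"
    and poincare: "\<And>t. t \<in> space T \<Longrightarrow>
      chi_square_div (noised (corrupt A \<sigma> (P \<theta>)) (\<nu> t)) (noised P\<^sub>Y (\<nu> t)) \<le>
      ennreal (1 / l) * expect (noised P\<^sub>Y (\<nu> t))
        (\<lambda>y. (norm (grad (\<lambda>z. noised (corrupt A \<sigma> (P \<theta>)) (\<nu> t) z / noised P\<^sub>Y (\<nu> t) z) y))\<^sup>2)"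
    and opt: "corrupt A \<sigma> (P \<theta>') = P\<^sub>Y"
      "distill_loss T \<nu> A \<sigma> f\<^sub>\<phi> f\<^sub>\<psi> (P \<theta>) \<le> distill_loss T \<nu> A \<sigma> f\<^sub>\<phi> f\<^sub>\<psi> (P \<theta>') + \<epsilon>"
    and fake: "avg_sq_dist T \<nu> P\<^sub>Y f\<^sub>\<phi> f\<^sub>\<psi> \<le> avg_sq_dist T \<nu> P\<^sub>Y f\<^sub>\<phi> (noised_score \<nu> P\<^sub>Y)"
  shows "avg_fisher T \<nu> (corrupt A \<sigma> (P \<theta>)) P\<^sub>Y \<le>
    6 * ((err2_sq T \<nu> P\<^sub>Y f\<^sub>\<phi> + \<epsilon>) + err2_sq T \<nu> P\<^sub>Y f\<^sub>\<phi> + err2_sq T \<nu> (corrupt A \<sigma> (P \<theta>)) f\<^sub>\<psi>)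
    + 9 * (max_ratio T \<nu> (corrupt A \<sigma> (P \<theta>)) P\<^sub>Y / ennreal l) * (err4_sq T \<nu> P\<^sub>Y f\<^sub>\<phi>)\<^sup>2"
proof -
  note S = setting[unfolded distill_setting_def]
  have PY: "prob_space P\<^sub>Y" "sets P\<^sub>Y = sets borel"
    unfolding P\<^sub>Y_def using S by (auto intro: prob_space_corrupt)
  have "G \<theta> \<in> measurable Z borel" using S \<theta> by blast
  then have "prob_space (P \<theta>)" unfolding P_def using S by (auto intro: prob_space.prob_space_distr)
  then have PG: "prob_space (corrupt A \<sigma> (P \<theta>))" "sets (corrupt A \<sigma> (P \<theta>)) = sets borel"
    using S by (auto intro: prob_space_corrupt simp: P_def)
  have "avg_fisher T \<nu> (corrupt A \<sigma> (P \<theta>)) P\<^sub>Y \<le>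
      6 * (avg_sq_dist T \<nu> (corrupt A \<sigma> (P \<theta>)) f\<^sub>\<phi> f\<^sub>\<psi> + err2_sq T \<nu> P\<^sub>Y f\<^sub>\<phi>
        + err2_sq T \<nu> (corrupt A \<sigma> (P \<theta>)) f\<^sub>\<psi>)
      + 9 * (max_ratio T \<nu> (corrupt A \<sigma> (P \<theta>)) P\<^sub>Y / ennreal l) * (err4_sq T \<nu> P\<^sub>Y f\<^sub>\<phi>)\<^sup>2"
    by (rule avg_fisher_le) (use S PY PG \<Delta> l poincare in auto)
  also have "avg_sq_dist T \<nu> (corrupt A \<sigma> (P \<theta>)) f\<^sub>\<phi> f\<^sub>\<psi> \<le> err2_sq T \<nu> P\<^sub>Y f\<^sub>\<phi> + \<epsilon>"
  proof -
    have "avg_sq_dist T \<nu> (corrupt A \<sigma> (P \<theta>)) f\<^sub>\<phi> f\<^sub>\<psi> \<le> avg_sq_dist T \<nu> P\<^sub>Y f\<^sub>\<phi> f\<^sub>\<psi> + \<epsilon>"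
      using opt unfolding distill_loss_def by simp
    also have "avg_sq_dist T \<nu> P\<^sub>Y f\<^sub>\<phi> f\<^sub>\<psi> \<le> err2_sq T \<nu> P\<^sub>Y f\<^sub>\<phi>"
      using fake avg_sq_dist_noised_score_le S by (metis order_trans)
    finally show ?thesis by (simp add: add_right_mono)
  qed
  finally show ?thesis by (simp add: add_right_mono mult_left_mono)
qed

(* A type-dependent witness for the existential could still depend on the dimensions of the
   two spaces, since formulas cannot quantify over types. The numerical cap on C excludes this
   and makes C an absolute constant. *)
theorem theorem5:
  "\<exists>C::real. 0 < C \<and> C \<le> 100 \<and>
    (\<forall>(T :: real measure) (\<nu> :: real \<Rightarrow> real) (A :: real^'d^'m) (\<sigma> :: real)
      (p\<^sub>X :: real^'d \<Rightarrow> real) (Z :: 'z measure) (\<Theta> :: 'p set) (G :: 'p \<Rightarrow> 'z \<Rightarrow> real^'d)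
      (f\<^sub>\<phi> :: real^'m \<Rightarrow> real \<Rightarrow> real^'m) (f\<^sub>\<psi> :: real^'m \<Rightarrow> real \<Rightarrow> real^'m)
      (\<theta>\<^sub>h :: 'p) (l\<^sub>0 :: real) (\<epsilon>\<^sub>o\<^sub>p\<^sub>t :: real).
     let P\<^sub>X = density lborel (\<lambda>x. ennreal (p\<^sub>X x));
         P\<^sub>Y = corrupt A \<sigma> P\<^sub>X;
         P\<^sub>G = (\<lambda>\<theta>. distr Z borel (G \<theta>));
         P\<^sub>G\<^sub>Y = (\<lambda>\<theta>. corrupt A \<sigma> (P\<^sub>G \<theta>));
         L = (\<lambda>\<theta>. distill_loss T \<nu> A \<sigma> f\<^sub>\<phi> f\<^sub>\<psi> (P\<^sub>G \<theta>));
         e2 = err2_sq T \<nu> P\<^sub>Y f\<^sub>\<phi>;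
         e4 = err4_sq T \<nu> P\<^sub>Y f\<^sub>\<phi>;
         e\<psi> = err2_sq T \<nu> (P\<^sub>G\<^sub>Y \<theta>\<^sub>h) f\<^sub>\<psi>;
         \<Delta> = max_ratio T \<nu> (P\<^sub>G\<^sub>Y \<theta>\<^sub>h) P\<^sub>Y;
         F\<^sub>X = avg_fisher T \<nu> (P\<^sub>G \<theta>\<^sub>h) P\<^sub>X;
         F\<^sub>Y = avg_fisher T \<nu> (P\<^sub>G\<^sub>Y \<theta>\<^sub>h) P\<^sub>Y
     in
       distill_setting T \<nu> \<sigma> p\<^sub>X Z \<Theta> G f\<^sub>\<phi> f\<^sub>\<psi> \<longrightarrow>
       \<theta>\<^sub>h \<in> \<Theta> \<longrightarrow>
       e2 < \<top> \<longrightarrow> e4 < \<top> \<longrightarrow> e\<psi> < \<top> \<longrightarrow> \<Delta> < \<top> \<longrightarrow>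
       0 < l\<^sub>0 \<longrightarrow>
       (\<forall>t\<in>space T. \<forall>\<theta>\<in>\<Theta>.
          let p = noised (P\<^sub>G\<^sub>Y \<theta>) (\<nu> t); q = noised P\<^sub>Y (\<nu> t)
          in chi_square_div p q \<le> ennreal (1 / l\<^sub>0) * expect q (\<lambda>y. (norm (grad (\<lambda>z. p z / q z) y))\<^sup>2)) \<longrightarrow>
       0 \<le> \<epsilon>\<^sub>o\<^sub>p\<^sub>t \<longrightarrow>
       (\<exists>\<theta>\<^sub>s\<in>\<Theta>. P\<^sub>G\<^sub>Y \<theta>\<^sub>s = P\<^sub>Y \<and> L \<theta>\<^sub>h \<le> L \<theta>\<^sub>s + ennreal \<epsilon>\<^sub>o\<^sub>p\<^sub>t) \<longrightarrow>
       avg_sq_dist T \<nu> P\<^sub>Y f\<^sub>\<phi> f\<^sub>\<psi> \<le> avg_sq_dist T \<nu> P\<^sub>Y f\<^sub>\<phi> (noised_score \<nu> P\<^sub>Y) \<longrightarrow>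
       F\<^sub>Y \<le> ennreal C * (e4 * ennsqrt (\<Delta> / ennreal l\<^sub>0)
                 + ennsqrt (e4\<^sup>2 * (\<Delta> / ennreal l\<^sub>0) + e2 + e\<psi> + ennreal \<epsilon>\<^sub>o\<^sub>p\<^sub>t))\<^sup>2 \<and>
       (\<forall>\<kappa>::real. 0 < \<kappa> \<longrightarrow> F\<^sub>X \<le> ennreal \<kappa> * F\<^sub>Y \<longrightarrow>
          F\<^sub>X \<le> ennreal C * ennreal \<kappa> * (e4 * ennsqrt (\<Delta> / ennreal l\<^sub>0)
                 + ennsqrt (4 * e4\<^sup>2 * (\<Delta> / ennreal l\<^sub>0) + e2 + e\<psi> + ennreal \<epsilon>\<^sub>o\<^sub>p\<^sub>t))\<^sup>2))"
proof -
  \<comment> \<open>Both conclusions follow from one linear bound, so the arithmetic is done for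
    arbitrary extended reals: \<open>x\<close> stands for the divergence \<open>F\<^sub>Y\<close>
    after corruption, \<open>y\<close> for \<open>F\<^sub>X\<close>, and \<open>c\<close> for the
    ratio of \<open>\<Delta>\<close> to \<open>l\<^sub>0\<close>.\<close>
  have bounds: "x \<le> ennreal 12 * (e4 * ennsqrt c + ennsqrt (e4\<^sup>2 * c + e2 + e\<psi> + \<epsilon>))\<^sup>2 \<and>
      (\<forall>\<kappa>::real. 0 < \<kappa> \<longrightarrow> y \<le> ennreal \<kappa> * x \<longrightarrow>
        y \<le> ennreal 12 * ennreal \<kappa> * (e4 * ennsqrt c + ennsqrt (4 * e4\<^sup>2 * c + e2 + e\<psi> + \<epsilon>))\<^sup>2)"
    if "x \<le> 6 * ((e2 + \<epsilon>) + e2 + e\<psi>) + 9 * c * e4\<^sup>2" for x y e2 e4 e\<psi> \<epsilon> c :: ennreal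
  proof (intro conjI allI impI)
    show x: "x \<le> ennreal 12 * (e4 * ennsqrt c + ennsqrt (e4\<^sup>2 * c + e2 + e\<psi> + \<epsilon>))\<^sup>2"
      using order_trans[OF that distill_bound_arith] by simp
    fix \<kappa> :: real assume y: "y \<le> ennreal \<kappa> * x"
    \<comment> \<open>The factor 4 in the second conclusion only enlarges the term under the root,
      so the first bound is weakened and then scaled by \<open>\<kappa>\<close>.\<close>
    have "1 * e4\<^sup>2 * c \<le> 4 * e4\<^sup>2 * c" by (intro mult_right_mono) simp_all
    then have "(e4 * ennsqrt c + ennsqrt (e4\<^sup>2 * c + e2 + e\<psi> + \<epsilon>))\<^sup>2
        \<le> (e4 * ennsqrt c + ennsqrt (4 * e4\<^sup>2 * c + e2 + e\<psi> + \<epsilon>))\<^sup>2"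
      by (intro power_mono add_mono ennsqrt_mono order_refl) simp_all
    then have "x \<le> ennreal 12 * (e4 * ennsqrt c + ennsqrt (4 * e4\<^sup>2 * c + e2 + e\<psi> + \<epsilon>))\<^sup>2"
      using x by (meson mult_left_mono order_trans zero_le)
    then have "ennreal \<kappa> * x
        \<le> ennreal \<kappa> * (ennreal 12 * (e4 * ennsqrt c + ennsqrt (4 * e4\<^sup>2 * c + e2 + e\<psi> + \<epsilon>))\<^sup>2)"
      by (rule mult_left_mono) simp
    then show "y \<le> ennreal 12 * ennreal \<kappa>
        * (e4 * ennsqrt c + ennsqrt (4 * e4\<^sup>2 * c + e2 + e\<psi> + \<epsilon>))\<^sup>2"
      using y by (simp only: mult.left_commute[of "ennreal \<kappa>"] mult.assoc)
  qed
  show ?thesis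
    unfolding Let_def
  \<comment> \<open>The witness 12 is the constant of \<open>distill_bound_arith\<close>. The first
    two goals are its numerical constraints, the third is the estimate.\<close>
  proof (intro exI[of _ 12] conjI[of "0 < 12"] conjI[of "12 \<le> 100"] allI impI, goal_cases)
    case (3 T \<nu> A \<sigma> p\<^sub>X Z \<Theta> G f\<^sub>\<phi> f\<^sub>\<psi> \<theta>\<^sub>h l\<^sub>0 \<epsilon>)
    then obtain \<theta>\<^sub>s where
      "corrupt A \<sigma> (distr Z borel (G \<theta>\<^sub>s)) = corrupt A \<sigma> (density lborel (\<lambda>x. ennreal (p\<^sub>X x)))"
      "distill_loss T \<nu> A \<sigma> f\<^sub>\<phi> f\<^sub>\<psi> (distr Z borel (G \<theta>\<^sub>h))
        \<le> distill_loss T \<nu> A \<sigma> f\<^sub>\<phi> f\<^sub>\<psi> (distr Z borel (G \<theta>\<^sub>s)) + ennreal \<epsilon>"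
      by blast
    with 3 show ?case
      by (intro bounds avg_fisher_distilled_le[where \<theta>' = \<theta>\<^sub>s and \<Theta> = \<Theta>]) blast+
  qed simp_all
qed

end
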